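(* Let $K$ be a field, $A$ a free abelian group of finite rank, and $W:A\to K$ an elliptic net such that $\Lambda=W^{-1}(0)$ is a subgroup of $A$ and $|A/\Lambda|\ge4$. Define $\delta:\Lambda\times(A\setminus\Lambda)\to K^\times$ by $\delta(\boldsymbol\lambda,\mathbf p)=W(\boldsymbol\lambda+\mathbf p)/W(\mathbf p)$. Then there exist well-defined functions $\chi:\Lambda\times A\to K^\times$ and $\xi:\Lambda\to K^\times$ given by $\chi(\boldsymbol\lambda,\mathbf p)=\delta(\boldsymbol\lambda,\mathbf p+\mathbf v)/\delta(\boldsymbol\lambda,\mathbf v)$ for any $\mathbf v\in A$ with $\mathbf v,\mathbf v+\mathbf p\notin\Lambda$ (independent of the choice of such $\mathbf v$), and $\xi(\boldsymbol\lambda)=\delta(\boldsymbol\lambda,\mathbf v)/\chi(\boldsymbol\lambda,\mathbf v)$ for any $\mathbf v\in A\setminus\Lambda$ (independent of the choice), such that $$W(\boldsymbol\lambda+\mathbf v)=\xi(\boldsymbol\lambda)\chi(\boldsymbol\lambda,\mathbf v)W(\mathbf v)\quad\text{for all }\boldsymbol\lambda\in\Lambda,\ \mathbf v\in A,$$ and: (i) $\chi$ is bilinear; (ii) $\chi(\boldsymbol\lambda_1,\boldsymbol\lambda_2)=\chi(\boldsymbol\lambda_2,\boldsymbol\lambda_1)$ for $\boldsymbol\lambda_1,\boldsymbol\lambda_2\in\Lambda$; (iii) $\xi(\boldsymbol\lambda_1+\boldsymbol\lambda_2)=\xi(\boldsymbol\lambda_1)\xi(\boldsymbol\lambda_2)\chi(\boldsymbol\lambda_1,\boldsymbol\lambda_2)$;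 (iv) $\xi(-\boldsymbol\lambda)=\xi(\boldsymbol\lambda)$; (v) $\xi(\boldsymbol\lambda)^2=\chi(\boldsymbol\lambda,\boldsymbol\lambda)$.
   Context: An elliptic net is a map $W:A\to K$ with $W(\mathbf 0)=0$ and $W(\mathbf p+\mathbf q+\mathbf s)W(\mathbf p-\mathbf q)W(\mathbf r+\mathbf s)W(\mathbf r)+W(\mathbf q+\mathbf r+\mathbf s)W(\mathbf q-\mathbf r)W(\mathbf p+\mathbf s)W(\mathbf p)+W(\mathbf r+\mathbf p+\mathbf s)W(\mathbf r-\mathbf p)W(\mathbf q+\mathbf s)W(\mathbf q)=0$ for all $\mathbf p,\mathbf q,\mathbf r,\mathbf s\in A$. *)

theory Defs
  imports "HOL-Algebra.Free_Abelian_Groups"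
begin

(* The additive group of a type of class ab_group_add as a HOL-Algebra group,
   in the same style as integer_group and free_Abelian_group. *)
definition additive_group :: "'a::ab_group_add monoid"
  where "additive_group = \<lparr>carrier = UNIV, monoid.mult = (+), one = 0\<rparr>"

lemma group_additive_group: "group (additive_group :: 'a::ab_group_add monoid)"
  by (rule groupI) (auto simp: additive_group_def add.assoc intro: exI[of _ "- _"])

definition elliptic_net :: "('a::ab_group_add \<Rightarrow> 'k::field) \<Rightarrow> bool"
  where "elliptic_net W \<longleftrightarrow>
    W 0 = 0 \<and>
    (\<forall>p q r s.
       W (p + q + s) * W (p - q) * W (r + s) * W r +
       W (q + r + s) * W (q - r) * W (p + s) * W p +
       W (r + p + s) * W (r - p) * W (q + s) * W q = 0)"

(* Only meaningful for l in the zero set of W and p outside it. *)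
definition net_delta :: "('a::ab_group_add \<Rightarrow> 'k::field) \<Rightarrow> 'a \<Rightarrow> 'a \<Rightarrow> 'k"
  where "net_delta W l p = W (l + p) / W p"

end

theory Submission
  imports Defs
begin

text \<open>
  Fix \<open>\<lambda>\<close> in the zero set and write \<open>\<delta>\<close> for \<open>\<delta>(\<lambda>, _)\<close>. Putting \<open>r = \<lambda>\<close> in the net recurrence kills
  its first term, and since \<open>W\<close> is odd the remaining two say that \<open>\<delta>(q + s) \<delta>(- q)\<close> does not depend
  on \<open>q\<close>. For \<open>s = 0\<close> this makes \<open>\<delta>(- q)\<close> a constant multiple of \<open>1 / \<delta>(q)\<close>, so \<open>\<delta>(q + s) / \<delta>(q)\<close>
  does not depend on \<open>q\<close> either and defines \<open>\<chi>(\<lambda>, s)\<close>. Additivity of \<open>\<chi>(\<lambda>, _)\<close> telescopes through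
  some \<open>v\<close> with \<open>v\<close>, \<open>v + p\<close>, \<open>v + p + q\<close> all outside \<open>\<Lambda>\<close>, that is, avoiding three cosets; this is
  where \<open>|A/\<Lambda>| \<ge> 4\<close> enters.
\<close>

text \<open>If no such \<open>v\<close> existed, every element would lie in one of the cosets of
  \<open>0\<close>, \<open>- p\<close>, \<open>- q\<close>, so the quotient would have at most three
  elements.\<close>

lemma exists_avoiding_three_cosets:
  assumes sub: "subgroup L (additive_group :: 'a::ab_group_add monoid)"
    and index: "infinite (carrier (additive_group Mod L)) \<or> order (additive_group Mod L) \<ge> 4"
  shows "\<exists>v. v \<notin> L \<and> v + p \<notin> L \<and> v + q \<notin> L"
proof (rule ccontr)
  let ?G = "additive_group :: 'a monoid"
  let ?C = "{L #>\<^bsub>?G\<^esub> 0, L #>\<^bsub>?G\<^esub> (- p), L #>\<^bsub>?G\<^esub> (- q)}"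
  interpret group ?G by (rule group_additive_group)
  assume "\<not> ?thesis"
  \<comment> \<open>The summand \<open>0\<close> lets the fact \<open>same\<close> treat all three
    cases alike.\<close>
  then have cover: "v + 0 \<in> L \<or> v + p \<in> L \<or> v + q \<in> L" for v by auto
  have same: "L #>\<^bsub>?G\<^esub> v = L #>\<^bsub>?G\<^esub> (- x)" if "v + x \<in> L" for v x
  proof (rule repr_independence[symmetric])
    show "v \<in> L #>\<^bsub>?G\<^esub> (- x)"
      using that by (force simp: r_coset_def additive_group_def)
  qed (use sub in \<open>auto simp: additive_group_def\<close>)
  have "L #>\<^bsub>?G\<^esub> v \<in> ?C" for v
    using cover[of v] same[of v 0] same[of v p] same[of v q] by auto
  then have "carrier (?G Mod L) \<subseteq> ?C"
    by (auto simp: FactGroup_def RCOSETS_def)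
  moreover have "finite ?C" "card ?C \<le> 3"
    by (auto simp: card_insert_if)
  ultimately have "finite (carrier (?G Mod L))" "card (carrier (?G Mod L)) \<le> 3"
    by (meson finite_subset card_mono le_trans)+
  with index show False by (simp add: order_def)
qed

text \<open>The subgroup axioms appear here in additive notation, and the size of the quotient
  enters only through \<open>avoid\<close>.\<close>

locale net_with_zero_subgroup =
  fixes W :: "'a::ab_group_add \<Rightarrow> 'k::field" and \<Lambda> :: "'a set"
  assumes net: "elliptic_net W"
    and zero_iff: "W x = 0 \<longleftrightarrow> x \<in> \<Lambda>"
    and add_mem: "\<lbrakk>x \<in> \<Lambda>; y \<in> \<Lambda>\<rbrakk> \<Longrightarrow> x + y \<in> \<Lambda>"
    and uminus_mem: "x \<in> \<Lambda> \<Longrightarrow> - x \<in> \<Lambda>"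
    and avoid: "\<exists>v. v \<notin> \<Lambda> \<and> v + p \<notin> \<Lambda> \<and> v + q \<notin> \<Lambda>"
begin

section \<open>The zero subgroup and oddness of the net\<close>

lemma recurrence:
  "W (p + q + s) * W (p - q) * W (r + s) * W r +
   W (q + r + s) * W (q - r) * W (p + s) * W p +
   W (r + p + s) * W (r - p) * W (q + s) * W q = 0"
  using net by (simp add: elliptic_net_def)

lemma zero_mem: "0 \<in> \<Lambda>"
  using net by (simp add: elliptic_net_def flip: zero_iff)

lemma uminus_mem_iff: "- x \<in> \<Lambda> \<longleftrightarrow> x \<in> \<Lambda>"
  using uminus_mem[of x] uminus_mem[of "- x"] by auto

lemma add_mem_iff: "l \<in> \<Lambda> \<Longrightarrow> l + x \<in> \<Lambda> \<longleftrightarrow> x \<in> \<Lambda>"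
  using add_mem[of l x] add_mem[of "- l" "l + x"] uminus_mem[of l]
  by (auto simp: add.assoc[symmetric])

lemma W_uminus: "W (- x) = - W x"
proof (cases "x \<in> \<Lambda>")
  case True
  then have "W x = 0" "W (- x) = 0" by (simp_all only: zero_iff uminus_mem)
  then show ?thesis by simp
next
  case False
  have "W 0 = 0" using zero_mem zero_iff by blast
  \<comment> \<open>At \<open>p = q = x\<close>, \<open>r = s = 0\<close> the first term of the
    recurrence vanishes and the other two share the factor \<open>W x ^ 3\<close>.\<close>
  then have "W x ^ 3 * (W x + W (- x)) = 0"
    using recurrence[where p = x and q = x and r = 0 and s = 0]
    by (simp add: power3_eq_cube algebra_simps)
  with False have "W x + W (- x) = 0" by (simp add: zero_iff)
  then show ?thesis by (simp add: eq_neg_iff_add_eq_0 add.commute)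
qed

section \<open>Ratios under translation by a zero\<close>

abbreviation \<delta> :: "'a \<Rightarrow> 'a \<Rightarrow> 'k"
  where "\<delta> \<equiv> net_delta W"

lemma delta_nonzero: "\<lbrakk>l \<in> \<Lambda>; p \<notin> \<Lambda>\<rbrakk> \<Longrightarrow> \<delta> l p \<noteq> 0"
  by (simp add: net_delta_def zero_iff add_mem_iff)

lemma delta_mult: "p \<notin> \<Lambda> \<Longrightarrow> \<delta> l p * W p = W (l + p)"
  by (simp add: net_delta_def zero_iff)

text \<open>Cocycle identity: the intermediate value \<open>W (m + p)\<close> is nonzero and
  cancels. It controls how \<chi> and \<xi> depend on their first argument.\<close>

lemma delta_add:
  assumes "m \<in> \<Lambda>" "p \<notin> \<Lambda>"
  shows "\<delta> (l + m) p = \<delta> l (m + p) * \<delta> m p"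
  using assms by (simp add: net_delta_def zero_iff add_mem_iff add.assoc)

lemma delta_shift_uminus:
  assumes l: "l \<in> \<Lambda>" and mem: "p \<notin> \<Lambda>" "q \<notin> \<Lambda>" "p + s \<notin> \<Lambda>" "q + s \<notin> \<Lambda>"
  shows "\<delta> l (q + s) * \<delta> l (- q) = \<delta> l (p + s) * \<delta> l (- p)"
proof -
  have uminus: "W (l - x) = - (\<delta> l (- x) * W x)" if "x \<notin> \<Lambda>" for x
    using delta_mult[of "- x" l] that by (simp add: uminus_mem_iff W_uminus)
  have swap: "W (q - l) = \<delta> l (- q) * W q"
    using W_uminus[of "l - q"] uminus[OF mem(2)] by simp
  have "W l = 0" using l zero_iff by blast
  then have "W (l + (q + s)) * W (q - l) * W (p + s) * W p +
      W (l + (p + s)) * W (l - p) * W (q + s) * W q = 0"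
    \<comment> \<open>The variables of \<open>recurrence\<close> are met in the order
      \<open>p\<close>, \<open>q\<close>, \<open>s\<close>, \<open>r\<close>, so this sets
      \<open>r = l\<close>; the first term then contains \<open>W l = 0\<close>.\<close>
    using recurrence[of p q s l] by (simp add: ac_simps)
  then have "\<delta> l (q + s) * W (q + s) * (\<delta> l (- q) * W q) * W (p + s) * W p =
      \<delta> l (p + s) * W (p + s) * (\<delta> l (- p) * W p) * W (q + s) * W q"
    unfolding swap uminus[OF mem(1)] delta_mult[OF mem(3)] delta_mult[OF mem(4)] by simp
  then have "(\<delta> l (q + s) * \<delta> l (- q)) * (W (q + s) * W q * W (p + s) * W p) =
      (\<delta> l (p + s) * \<delta> l (- p)) * (W (q + s) * W q * W (p + s) * W p)"
    by (simp add: ac_simps)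
  then show ?thesis using mem by (simp add: zero_iff)
qed

lemma delta_ratio_independent:
  assumes l: "l \<in> \<Lambda>" and mem: "p \<notin> \<Lambda>" "q \<notin> \<Lambda>" "s + p \<notin> \<Lambda>" "s + q \<notin> \<Lambda>"
  shows "\<delta> l (s + q) / \<delta> l q = \<delta> l (s + p) / \<delta> l p"
proof -
  have nz: "\<delta> l p \<noteq> 0" "\<delta> l q \<noteq> 0" "\<delta> l (- p) \<noteq> 0" "\<delta> l (- q) \<noteq> 0"
    using l mem by (auto simp: delta_nonzero uminus_mem_iff)
  have 0: "\<delta> l q * \<delta> l (- q) = \<delta> l p * \<delta> l (- p)"
    using delta_shift_uminus[of l p q 0] l mem by simp
  have s: "\<delta> l (s + q) * \<delta> l (- q) = \<delta> l (s + p) * \<delta> l (- p)"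
    using delta_shift_uminus[of l p q s] l mem by (simp add: add.commute)
  \<comment> \<open>After expanding by \<open>\<delta> l (- q)\<close>, numerator and denominator
    can each be moved from \<open>q\<close> to \<open>p\<close>.\<close>
  have "\<delta> l (s + q) / \<delta> l q = (\<delta> l (s + q) * \<delta> l (- q)) / (\<delta> l q * \<delta> l (- q))"
    using nz by simp
  also have "\<dots> = \<delta> l (s + p) / \<delta> l p"
    unfolding 0 s using nz by simp
  finally show ?thesis .
qed

section \<open>The bilinear factor\<close>

definition base_point :: "'a \<Rightarrow> 'a"
  where "base_point p = (SOME v. v \<notin> \<Lambda> \<and> p + v \<notin> \<Lambda>)"

definition \<chi> :: "'a \<Rightarrow> 'a \<Rightarrow> 'k"
  where "\<chi> l p = \<delta> l (p + base_point p) / \<delta> l (base_point p)"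

lemma base_point: "base_point p \<notin> \<Lambda>" "p + base_point p \<notin> \<Lambda>"
proof -
  have "\<exists>v. v \<notin> \<Lambda> \<and> p + v \<notin> \<Lambda>"
    using avoid[of p p] by (auto simp: add.commute)
  from someI_ex[OF this] show "base_point p \<notin> \<Lambda>" "p + base_point p \<notin> \<Lambda>"
    unfolding base_point_def by auto
qed

lemma chi_eq: "\<lbrakk>l \<in> \<Lambda>; v \<notin> \<Lambda>; p + v \<notin> \<Lambda>\<rbrakk> \<Longrightarrow> \<chi> l p = \<delta> l (p + v) / \<delta> l v"
  unfolding \<chi>_def by (intro delta_ratio_independent base_point)

lemma chi_nonzero: "l \<in> \<Lambda> \<Longrightarrow> \<chi> l p \<noteq> 0"
  by (simp add: \<chi>_def delta_nonzero base_point)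

lemma chi_add_right:
  assumes l: "l \<in> \<Lambda>"
  shows "\<chi> l (p + q) = \<chi> l p * \<chi> l q"
proof -
  \<comment> \<open>Now \<open>v\<close> is a base point for \<open>q\<close> and
    \<open>p + q\<close>, and \<open>q + v\<close> is one for \<open>p\<close>, so the ratios
    telescope.\<close>
  obtain v where v: "v \<notin> \<Lambda>" "v + q \<notin> \<Lambda>" "v + (p + q) \<notin> \<Lambda>"
    using avoid by blast
  then have mem: "q + v \<notin> \<Lambda>" "p + (q + v) \<notin> \<Lambda>" "(p + q) + v \<notin> \<Lambda>"
    by (simp_all add: ac_simps)
  have "\<chi> l (p + q) = \<delta> l (p + (q + v)) / \<delta> l v"
    using chi_eq[OF l v(1) mem(3)] by (simp add: add.assoc)
  then show ?thesis
    using chi_eq[OF l v(1) mem(1)] chi_eq[OF l mem(1,2)] delta_nonzero[OF l mem(1)] by simp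
qed

text \<open>The cocycle identity at \<open>p + v\<close> and at \<open>v\<close> splits the ratio;
  the part for \<open>l\<close> is then based at \<open>m + v\<close> instead of \<open>v\<close>,
  which \<open>chi_eq\<close> permits.\<close>

lemma chi_add_left:
  assumes l: "l \<in> \<Lambda>" and m: "m \<in> \<Lambda>"
  shows "\<chi> (l + m) p = \<chi> l p * \<chi> m p"
proof -
  define v where "v = base_point p"
  have v: "v \<notin> \<Lambda>" "p + v \<notin> \<Lambda>" unfolding v_def by (rule base_point)+
  have mv: "m + v \<notin> \<Lambda>" "p + (m + v) \<notin> \<Lambda>"
    using v m by (simp_all add: add_mem_iff add.left_commute[of p m])
  have "\<chi> (l + m) p = (\<delta> l (m + (p + v)) * \<delta> m (p + v)) / (\<delta> l (m + v) * \<delta> m v)"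
    using chi_eq[OF add_mem[OF l m] v] delta_add m v by simp
  then show ?thesis
    using chi_eq[OF l mv] chi_eq[OF m v] by (simp add: add.left_commute)
qed

text \<open>With a common base point \<open>v\<close>, both sides equal
  \<open>W (l + m + v) * W v / (W (l + v) * W (m + v))\<close>, which is symmetric in
  \<open>l\<close> and \<open>m\<close>.\<close>

lemma chi_commute:
  assumes l: "l \<in> \<Lambda>" and m: "m \<in> \<Lambda>"
  shows "\<chi> l m = \<chi> m l"
proof -
  obtain v where v: "v \<notin> \<Lambda>" using avoid by blast
  have mem: "l + v \<notin> \<Lambda>" "m + v \<notin> \<Lambda>" using l m v by (simp_all add: add_mem_iff)
  show ?thesis
    using chi_eq[OF l v mem(2)] chi_eq[OF m v mem(1)]
    by (simp add: net_delta_def add.left_commute mult.commute)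
qed

lemma chi_zero_right: "l \<in> \<Lambda> \<Longrightarrow> \<chi> l 0 = 1"
  using chi_add_right[of l 0 0] chi_nonzero[of l 0] by simp

lemma chi_uminus_right: "l \<in> \<Lambda> \<Longrightarrow> \<chi> l (- p) = 1 / \<chi> l p"
  using chi_add_right[of l p "- p"] chi_nonzero[of l p]
  by (simp add: chi_zero_right eq_divide_eq mult.commute)

lemma chi_zero_left: "\<chi> 0 p = 1"
  using chi_add_left[OF zero_mem zero_mem, of p] chi_nonzero[OF zero_mem, of p] by simp

lemma chi_uminus_left: "l \<in> \<Lambda> \<Longrightarrow> \<chi> (- l) p = 1 / \<chi> l p"
  using chi_add_left[of l "- l" p] chi_nonzero[of l p] uminus_mem[of l]
  by (simp add: chi_zero_left eq_divide_eq mult.commute)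

section \<open>The quadratic factor\<close>

definition \<xi> :: "'a \<Rightarrow> 'k"
  where "\<xi> l = \<delta> l (base_point 0) / \<chi> l (base_point 0)"

text \<open>Basing \<open>\<chi> l (v - w)\<close> at \<open>w\<close> gives
  \<open>\<delta> l v / \<delta> l w\<close>, while additivity gives
  \<open>\<chi> l v / \<chi> l w\<close>. Here \<open>base_point 0\<close> is merely some point
  outside \<Lambda>.\<close>

lemma xi_eq:
  assumes l: "l \<in> \<Lambda>" and v: "v \<notin> \<Lambda>"
  shows "\<xi> l = \<delta> l v / \<chi> l v"
proof -
  define w where "w = base_point 0"
  have w: "w \<notin> \<Lambda>" unfolding w_def by (rule base_point)
  have "\<chi> l v = \<chi> l (v - w) * \<chi> l w"
    using chi_add_right[OF l, of "v - w" w] by simp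
  moreover have "\<chi> l (v - w) = \<delta> l v / \<delta> l w"
    using chi_eq[OF l w, of "v - w"] v by simp
  ultimately have "\<chi> l v = \<delta> l v / \<delta> l w * \<chi> l w" by simp
  then show ?thesis
    unfolding \<xi>_def w_def[symmetric]
    using delta_nonzero[OF l v] delta_nonzero[OF l w] by simp
qed

lemma xi_nonzero: "l \<in> \<Lambda> \<Longrightarrow> \<xi> l \<noteq> 0"
  by (simp add: \<xi>_def delta_nonzero chi_nonzero base_point)

lemma delta_eq_xi_chi: "\<lbrakk>l \<in> \<Lambda>; v \<notin> \<Lambda>\<rbrakk> \<Longrightarrow> \<delta> l v = \<xi> l * \<chi> l v"
  by (simp add: xi_eq[of l v] chi_nonzero)

lemma W_add:
  assumes l: "l \<in> \<Lambda>"
  shows "W (l + v) = \<xi> l * \<chi> l v * W v"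
proof (cases "v \<in> \<Lambda>")
  case True
  with l have "W v = 0" "W (l + v) = 0" by (simp_all add: zero_iff add_mem)
  then show ?thesis by simp
next
  case False
  with l show ?thesis by (simp add: delta_mult flip: delta_eq_xi_chi)
qed

text \<open>Substituting \<delta> = \<xi>\<chi> into the cocycle identity, the factor
  \<open>\<chi> l m\<close> comes from expanding \<open>\<chi> l (m + v)\<close>.\<close>

lemma xi_add:
  assumes l: "l \<in> \<Lambda>" and m: "m \<in> \<Lambda>"
  shows "\<xi> (l + m) = \<xi> l * \<xi> m * \<chi> l m"
proof -
  obtain v where v: "v \<notin> \<Lambda>" using avoid by blast
  have mv: "m + v \<notin> \<Lambda>" using m v by (simp add: add_mem_iff)
  have "\<xi> (l + m) * \<chi> (l + m) v = \<xi> l * \<chi> l (m + v) * (\<xi> m * \<chi> m v)"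
    using delta_add[OF m v, of l] l m v mv by (simp add: delta_eq_xi_chi add_mem)
  then show ?thesis
    using chi_nonzero[OF l, of v] chi_nonzero[OF m, of v]
    by (simp add: chi_add_left[OF l m] chi_add_right[OF l])
qed

text \<open>Oddness relates the values at \<open>- l + v\<close> and \<open>l - v\<close>. Expanding
  both by \<open>W_add\<close>, the factors \<open>\<chi> (- l) v\<close> and
  \<open>\<chi> l (- v)\<close> agree and cancel.\<close>

lemma xi_uminus:
  assumes l: "l \<in> \<Lambda>"
  shows "\<xi> (- l) = \<xi> l"
proof -
  obtain v where v: "v \<notin> \<Lambda>" using avoid by blast
  then have "W v \<noteq> 0" by (simp add: zero_iff)
  moreover have "W (- l + v) = - W (l + - v)"
    using W_uminus[of "l + - v"] by simp
  then have "\<xi> (- l) * \<chi> (- l) v * W v = \<xi> l * \<chi> l (- v) * W v"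
    unfolding W_add[OF l] W_add[OF uminus_mem[OF l]] W_uminus by simp
  ultimately show ?thesis
    using chi_nonzero[OF l, of v] by (simp add: chi_uminus_left chi_uminus_right l)
qed

lemma xi_zero: "\<xi> 0 = 1"
  using xi_add[OF zero_mem zero_mem] xi_nonzero[OF zero_mem] by (simp add: chi_zero_left)

text \<open>Adding \<open>l\<close> and \<open>- l\<close> gives
  \<open>1 = \<xi> l * \<xi> (- l) * \<chi> l (- l)\<close>, where
  \<open>\<xi> (- l) = \<xi> l\<close> and \<open>\<chi> l (- l) = 1 / \<chi> l l\<close>.\<close>

lemma xi_square:
  assumes l: "l \<in> \<Lambda>"
  shows "(\<xi> l)\<^sup>2 = \<chi> l l"
  using xi_add[OF l uminus_mem[OF l]] chi_nonzero[OF l, of l]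
  by (simp add: xi_uminus xi_zero chi_uminus_right l power2_eq_square)

end

theorem theorem1p12:
  fixes W :: "'a::ab_group_add \<Rightarrow> 'k::field"
    and \<Lambda> :: "'a set"
    and n :: nat
  assumes free: "(additive_group :: 'a monoid) \<cong> free_Abelian_group {..<n}"
    and net: "elliptic_net W"
    and zeros: "\<Lambda> = W -` {0}"
    and subgroup: "subgroup \<Lambda> additive_group"
    and index: "infinite (carrier (additive_group Mod \<Lambda>)) \<or> order (additive_group Mod \<Lambda>) \<ge> 4"
  shows "(\<forall>l\<in>\<Lambda>. \<forall>p. p \<notin> \<Lambda> \<longrightarrow> net_delta W l p \<noteq> 0) \<and>
    (\<forall>p. \<exists>v. v \<notin> \<Lambda> \<and> v + p \<notin> \<Lambda>) \<and>
    (\<exists>\<chi> :: 'a \<Rightarrow> 'a \<Rightarrow> 'k. \<exists>\<xi> :: 'a \<Rightarrow> 'k.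
      (\<forall>l\<in>\<Lambda>. \<forall>p. \<chi> l p \<noteq> 0) \<and>
      (\<forall>l\<in>\<Lambda>. \<xi> l \<noteq> 0) \<and>
      (\<forall>l\<in>\<Lambda>. \<forall>p v. v \<notin> \<Lambda> \<longrightarrow> v + p \<notin> \<Lambda> \<longrightarrow>
          \<chi> l p = net_delta W l (p + v) / net_delta W l v) \<and>
      (\<forall>l\<in>\<Lambda>. \<forall>v. v \<notin> \<Lambda> \<longrightarrow> \<xi> l = net_delta W l v / \<chi> l v) \<and>
      (\<forall>l\<in>\<Lambda>. \<forall>v. W (l + v) = \<xi> l * \<chi> l v * W v) \<and>
      (\<forall>l1\<in>\<Lambda>. \<forall>l2\<in>\<Lambda>. \<forall>p. \<chi> (l1 + l2) p = \<chi> l1 p * \<chi> l2 p) \<and>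
      (\<forall>l\<in>\<Lambda>. \<forall>p q. \<chi> l (p + q) = \<chi> l p * \<chi> l q) \<and>
      (\<forall>l1\<in>\<Lambda>. \<forall>l2\<in>\<Lambda>. \<chi> l1 l2 = \<chi> l2 l1) \<and>
      (\<forall>l1\<in>\<Lambda>. \<forall>l2\<in>\<Lambda>. \<xi> (l1 + l2) = \<xi> l1 * \<xi> l2 * \<chi> l1 l2) \<and>
      (\<forall>l\<in>\<Lambda>. \<xi> (- l) = \<xi> l) \<and>
      (\<forall>l\<in>\<Lambda>. (\<xi> l)\<^sup>2 = \<chi> l l))"
proof -
  interpret net_with_zero_subgroup W \<Lambda>
  proof
    show "W x = 0 \<longleftrightarrow> x \<in> \<Lambda>" for x by (simp add: zeros)
    show "x + y \<in> \<Lambda>" if "x \<in> \<Lambda>" "y \<in> \<Lambda>" for x y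
      using subgroup.m_closed[OF subgroup that] by (simp add: additive_group_def)
    show "- x \<in> \<Lambda>" if "x \<in> \<Lambda>" for x
    proof -
      have "inv\<^bsub>additive_group\<^esub> x = - x"
        by (rule group.inv_equality[OF group_additive_group]) (auto simp: additive_group_def)
      with subgroup.m_inv_closed[OF subgroup that] show ?thesis by simp
    qed
  qed (use net exists_avoiding_three_cosets[OF subgroup index] in auto)
  have avoid2: "\<exists>v. v \<notin> \<Lambda> \<and> v + p \<notin> \<Lambda>" for p
    using avoid by blast
  have chi_eq': "\<chi> l p = net_delta W l (p + v) / net_delta W l v"
    if "l \<in> \<Lambda>" "v \<notin> \<Lambda>" "v + p \<notin> \<Lambda>" for l p v
    using chi_eq[of l v p] that by (simp add: add.commute)
  show ?thesis
    by (intro conjI exI[of _ \<chi>] exI[of _ \<xi>] ballI allI impI)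
      (rule delta_nonzero avoid2 chi_nonzero xi_nonzero chi_eq' xi_eq W_add chi_add_left
        chi_add_right chi_commute xi_add xi_uminus xi_square; assumption)+
qed

end
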